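(* Let $f\in\mathcal{S}$ be given by $f(z)=z+a_2z^2+a_3z^3+\cdots$, and let $\gamma_n$ ($n\ge 1$) be its logarithmic coefficients, defined by $$\log\frac{f(z)}{z}=2\sum_{n=1}^\infty \gamma_n z^n .$$ Then $$|\gamma_4|\le 0.51059\ldots.$$
   Context: $\mathcal{S}$ denotes the class of functions $f$ that are analytic and univalent (injective) in the open unit disk $\mathbb{D}=\{z\in\mathbb{C}:|z|<1\}$ and normalized so that $f(z)=z+\sum_{n=2}^\infty a_n z^n$. The logarithm $\log\frac{f(z)}{z}$ is the analytic branch on $\mathbb{D}$ vanishing at $z=0$. The bound is a numerical constant given by its truncated decimal expansion $0.51059\ldots$. *)

theory Defs
  imports "HOL-Complex_Analysis.Complex_Analysis"
begin

definition class_S :: "(complex \<Rightarrow> complex) set" where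
  "class_S = {f. f holomorphic_on ball 0 1 \<and> inj_on f (ball 0 1) \<and> f 0 = 0 \<and> deriv f 0 = 1}"

(* f z / z has a removable singularity at 0 with value 1, whereas f 0 / 0 = 0 in HOL; hence the
   point 0 is excluded, and g 0 = 0 selects the branch. *)
definition is_log_ratio :: "(complex \<Rightarrow> complex) \<Rightarrow> (complex \<Rightarrow> complex) \<Rightarrow> bool" where
  "is_log_ratio f g \<longleftrightarrow> g holomorphic_on ball 0 1 \<and> g 0 = 0 \<and>
     (\<forall>z\<in>ball 0 1 - {0}. exp (g z) = f z / z)"

(* Only the values at n > 0 matter; the value at index 0 is left unconstrained. *)
definition log_coeffs :: "(complex \<Rightarrow> complex) \<Rightarrow> (nat \<Rightarrow> complex) \<Rightarrow> bool" where
  "log_coeffs f \<gamma> \<longleftrightarrow> (\<exists>g. is_log_ratio f g \<and>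
     (\<forall>z\<in>ball 0 1. (\<lambda>n. 2 * (\<gamma> (Suc n) * z ^ Suc n)) sums g z))"

lemma class_S_expansion:
  assumes "f \<in> class_S"
  shows "\<exists>a. \<forall>z\<in>ball 0 1. (\<lambda>n. a (n + 2) * z ^ (n + 2)) sums (f z - z)"
proof -
  define a where "a = (\<lambda>n. (deriv ^^ n) f 0 / fact n)"
  have "(\<lambda>n. a (n + 2) * z ^ (n + 2)) sums (f z - z)" if z: "z \<in> ball 0 1" for z
  proof -
    have "(\<lambda>n. a n * z ^ n) sums f z"
      using holomorphic_power_series[of f 0 1 z] assms z by (simp add: class_S_def a_def)
    from sums_split_initial_segment[OF this, of 2]
    show ?thesis using assms by (simp add: class_S_def a_def numeral_2_eq_2)
  qed
  then show ?thesis by blast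
qed

lemma is_log_ratio_exists:
  assumes "f \<in> class_S"
  shows "\<exists>g. is_log_ratio f g"
proof -
  have f: "f holomorphic_on ball 0 1" "inj_on f (ball 0 1)" "f 0 = 0" "deriv f 0 = 1"
    using assms by (auto simp: class_S_def)
  define h where "h = (\<lambda>z. if z = 0 then 1 else f z / z)"
  have hol: "h holomorphic_on ball 0 1"
    using pole_lemma_open[OF f(1) open_ball, of 0] f by (simp add: h_def cong: if_cong)
  have nz: "h z \<noteq> 0" if "z \<in> ball 0 1" for z
    using that f inj_onD[OF f(2), of z 0] by (auto simp: h_def)
  obtain g where g: "g holomorphic_on ball 0 1" "\<And>z. z \<in> ball 0 1 \<Longrightarrow> h z = exp (g z)"
    using contractible_imp_holomorphic_log[OF hol convex_imp_contractible[OF convex_ball] nz] by blast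
  have "exp (g 0) = 1" using g(2)[of 0] by (simp add: h_def)
  then have "is_log_ratio f (\<lambda>z. g z - g 0)"
    using g unfolding is_log_ratio_def
    by (auto intro!: holomorphic_intros simp: exp_diff h_def simp flip: g(2))
  then show ?thesis by blast
qed

lemma log_coeffs_exist:
  assumes "f \<in> class_S"
  shows "\<exists>\<gamma>. log_coeffs f \<gamma>"
proof -
  obtain g where g: "is_log_ratio f g" using is_log_ratio_exists[OF assms] ..
  define \<gamma> where "\<gamma> = (\<lambda>n. (deriv ^^ n) g 0 / fact n / 2)"
  have "(\<lambda>n. 2 * (\<gamma> (Suc n) * z ^ Suc n)) sums g z" if z: "z \<in> ball 0 1" for z
  proof -
    have "(\<lambda>n. 2 * (\<gamma> n * z ^ n)) sums g z"
      using holomorphic_power_series[of g 0 1 z] g z by (simp add: is_log_ratio_def \<gamma>_def)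
    from sums_split_initial_segment[OF this, of 1]
    show ?thesis using g by (simp add: is_log_ratio_def \<gamma>_def)
  qed
  with g show ?thesis unfolding log_coeffs_def by blast
qed

lemma is_log_ratio_unique:
  assumes "is_log_ratio f g" "is_log_ratio f h" "z \<in> ball 0 1"
  shows "g z = h z"
proof -
  have e: "exp (g w - h w) = 1" if "w \<in> ball 0 1" for w
  proof (cases "w = 0")
    case False
    then have "exp (g w) = exp (h w)"
      using assms that by (auto simp: is_log_ratio_def)
    then show ?thesis by (simp add: exp_diff)
  qed (use assms in \<open>auto simp: is_log_ratio_def\<close>)
  have hol: "g holomorphic_on ball 0 1" "h holomorphic_on ball 0 1"
    using assms by (auto simp: is_log_ratio_def)
  have "((\<lambda>w. g w - h w) has_field_derivative 0) (at w within ball 0 1)"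
    if w: "w \<in> ball 0 1" for w
  proof -
    have d: "((\<lambda>w. g w - h w) has_field_derivative (deriv g w - deriv h w)) (at w)"
      using hol w by (auto intro!: derivative_intros holomorphic_derivI[of _ "ball 0 1"])
    have "((\<lambda>w. exp (g w - h w)) has_field_derivative
            exp (g w - h w) * (deriv g w - deriv h w)) (at w)"
      by (rule DERIV_chain2[OF DERIV_exp d])
    moreover have "((\<lambda>w. exp (g w - h w)) has_field_derivative 0) (at w)"
      by (rule has_field_derivative_transform_within_open[OF DERIV_const[of 1] open_ball w])
         (simp add: e)
    ultimately have "exp (g w - h w) * (deriv g w - deriv h w) = 0"
      by (rule DERIV_unique)
    then show ?thesis using d by (auto intro: has_field_derivative_at_within)
  qed
  then obtain c where c: "\<And>w. w \<in> ball 0 1 \<Longrightarrow> g w - h w = c"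
    using has_field_derivative_zero_constant[OF convex_ball, of 0 1 "\<lambda>w. g w - h w"] by blast
  show ?thesis using c[of 0] c[OF assms(3)] assms by (simp add: is_log_ratio_def)
qed

lemma log_coeffs_unique:
  assumes "log_coeffs f \<gamma>" "log_coeffs f \<delta>" "n > 0"
  shows "\<gamma> n = \<delta> n"
proof -
  obtain g where g: "is_log_ratio f g"
    and sg: "\<And>z. z \<in> ball 0 1 \<Longrightarrow> (\<lambda>n. 2 * (\<gamma> (Suc n) * z ^ Suc n)) sums g z"
    using assms(1) unfolding log_coeffs_def by blast
  obtain h where h: "is_log_ratio f h"
    and sh: "\<And>z. z \<in> ball 0 1 \<Longrightarrow> (\<lambda>n. 2 * (\<delta> (Suc n) * z ^ Suc n)) sums h z"
    using assms(2) unfolding log_coeffs_def by blast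
  have key: "(\<lambda>n. (if n = 0 then 0 else 2 * (\<gamma> n - \<delta> n)) * z ^ n) sums 0"
    if "norm z < 1" for z :: complex
  proof -
    have "z \<in> ball 0 1" using that by simp
    then have "(\<lambda>n. 2 * ((\<gamma> (Suc n) - \<delta> (Suc n)) * z ^ Suc n)) sums 0"
      using sums_diff[OF sg sh, of z z] is_log_ratio_unique[OF g h, of z]
      by (simp add: algebra_simps)
    then show ?thesis
      using sums_Suc_iff[of "\<lambda>n. (if n = 0 then 0 else 2 * (\<gamma> n - \<delta> n)) * z ^ n" 0]
      by (simp add: algebra_simps)
  qed
  show ?thesis
  proof (rule ccontr)
    assume "\<gamma> n \<noteq> \<delta> n"
    then obtain s where "0 < s" and s: "\<And>z::complex. z \<in> cball 0 s - {0} \<Longrightarrow> (0::complex) \<noteq> 0"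
      using powser_0_nonzero[of 1 0 "\<lambda>n. if n = 0 then 0 else 2 * (\<gamma> n - \<delta> n)"
          "\<lambda>_. 0" n] key \<open>n > 0\<close> by auto
    then show False using s[of "of_real s"] by simp
  qed
qed

end

theory Submission
  imports Defs
begin

text \<open>Let \<open>E u = exp (- g u / 2)\<close> with \<open>g\<close> the logarithm of \<open>f z / z\<close>, and let \<open>E\<^sub>n\<close> be its
  coefficients. The function \<open>z \<mapsto> E (z\<^sup>2) / z\<close>, the reciprocal of the square root transform of \<open>f\<close>,
  is univalent in the punctured disc, so Gronwall's area theorem gives
  \<open>\<bar>E\<^sub>1\<bar>\<^sup>2 + 3 \<bar>E\<^sub>2\<bar>\<^sup>2 + 5 \<bar>E\<^sub>3\<bar>\<^sup>2 + 7 \<bar>E\<^sub>4\<bar>\<^sup>2 \<le> 1\<close>. Since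
  \<open>\<gamma>\<^sub>4 = - E\<^sub>4 + E\<^sub>1 E\<^sub>3 + E\<^sub>2\<^sup>2 / 2 - E\<^sub>1\<^sup>2 E\<^sub>2 + E\<^sub>1\<^sup>4 / 4\<close>, the bound is the maximum of a quartic on an
  ellipsoid (about \<open>0.51059004\<close>).

  For the area theorem, compare the area of the image of the annulus
  \<open>s < \<bar>z\<bar> < 1 - s\<close> under \<open>z \<mapsto> 1 / z + \<beta> z\<close> with that of the image of \<open>\<bar>w\<bar> < 1 / s\<close> under
  \<open>w \<mapsto> w + \<beta> (s\<^sup>2 cnj w)\<close>, which has the same boundary values, Jacobian at most \<open>1\<close>,
  and contains the former image; then let \<open>s\<close> tend to \<open>0\<close>.\<close>

section \<open>Transfer of plane integrals between \<open>complex\<close> and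
  \<open>real^2\<close>\<close>

text \<open>Areas are measured in \<open>real^2\<close>, where change of variables uses the
  determinant of a Jacobian matrix, while the functions stay on \<open>complex\<close>.\<close>

definition complex_of_vec :: "real^2 \<Rightarrow> complex" where "complex_of_vec x = Complex (x $ 1) (x $ 2)"

definition vec_of_complex :: "complex \<Rightarrow> real^2" where "vec_of_complex z = (\<chi> i. if i = 1 then Re z else Im z)"

lemma complex_of_vec_vec_of_complex [simp]: "complex_of_vec (vec_of_complex z) = z"
  by (simp add: complex_of_vec_def vec_of_complex_def)

lemma vec_of_complex_complex_of_vec [simp]: "vec_of_complex (complex_of_vec z) = z"
  by (simp add: complex_of_vec_def vec_of_complex_def vec_eq_iff forall_2)

lemma bounded_linear_complex_of_vec: "bounded_linear complex_of_vec"
  by (intro linear_conv_bounded_linear[THEN iffD1] linearI) (auto simp: complex_of_vec_def complex_eq_iff)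

lemma bounded_linear_vec_of_complex: "bounded_linear vec_of_complex"
  by (intro linear_conv_bounded_linear[THEN iffD1] linearI) (auto simp: vec_of_complex_def vec_eq_iff)

lemma norm_complex_of_vec [simp]: "norm (complex_of_vec x) = norm x"
  by (simp add: complex_of_vec_def cmod_def norm_vec_def L2_set_def sum_2)

text \<open>The Jacobian in Wirtinger form: \<open>a\<close> and \<open>b\<close> stand for the
  derivatives in z and in its conjugate. Holomorphic maps have \<open>b = 0\<close>; the maps
  \<open>w + \<phi> (cnj w)\<close> have \<open>a = 1\<close>.\<close>

lemma det_real_linear_complex:
  "det (matrix (\<lambda>v. vec_of_complex (a * complex_of_vec v + b * cnj (complex_of_vec v)))) = (cmod a)\<^sup>2 - (cmod b)\<^sup>2"
  by (simp add: det_2 matrix_def vec_of_complex_def complex_of_vec_def axis_def cmod_power2 algebra_simps flip: power2_eq_square)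

text \<open>Fubini, transported: the iterated integral is one over a box of pairs, and
  \<open>g\<close>, with inverse \<open>h\<close>, maps boxes of \<open>real^2\<close> onto boxes of
  pairs with the same content.\<close>

lemma has_integral_complex_of_vec:
  fixes f :: "complex \<Rightarrow> real"
  assumes f: "continuous_on (cbox p q) f"
  shows "((\<lambda>x. f (complex_of_vec x)) has_integral
      integral {Re p..Re q} (\<lambda>x. integral {Im p..Im q} (\<lambda>y. f (Complex x y)))) (vec_of_complex ` cbox p q)"
proof -
  define g where "g = (\<lambda>x :: real^2. (x $ 1, x $ 2))"
  define h where "h = (\<lambda>(x,y). vec_of_complex (Complex x y))"
  have hg: "h (g x) = x" "g (h y) = y" for x y
    by (auto simp: g_def h_def vec_of_complex_def vec_eq_iff forall_2 split_beta)
  have gi: "g ` cbox u v = cbox (g u) (g v)" for u v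
  proof -
    have "y \<in> g ` cbox u v" if "y \<in> cbox (g u) (g v)" for y
      using that by (intro image_eqI[of _ _ "h y"])
        (auto simp: g_def h_def vec_of_complex_def mem_box_cart forall_2 split_beta cbox_Pair_eq mem_Times_iff)
    then show ?thesis by (auto simp: g_def mem_box_cart forall_2)
  qed
  have hi: "h ` cbox u v = cbox (h u) (h v)" for u v
  proof -
    have "cbox u v = g ` cbox (h u) (h v)" by (simp add: gi hg)
    then show ?thesis by (simp add: image_image hg)
  qed
  have content: "measure lborel (g ` cbox u v) = 1 * measure lborel (cbox u v)" for u v
  proof (cases "cbox u v = {}")
    case False
    then have "u $ 1 \<le> v $ 1" "u $ 2 \<le> v $ 2" by (auto simp: interval_ne_empty_cart forall_2)
    with False show ?thesis unfolding gi by (simp add: g_def content_Pair content_cbox_cart UNIV_2)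
  qed simp
  have c: "continuous_on (cbox (Re p, Im p) (Re q, Im q)) (\<lambda>(x,y). f (Complex x y))"
    unfolding split_beta
    by (rule continuous_on_compose2[OF f]) (auto intro!: continuous_intros simp: Complex_eq in_cbox_complex_iff)
  have "((\<lambda>(x,y). f (Complex x y)) has_integral integral (cbox (Re p, Im p) (Re q, Im q)) (\<lambda>(x,y). f (Complex x y)))
     (cbox (Re p, Im p) (Re q, Im q))"
    using integrable_continuous[OF c] by (rule integrable_integral)
  then have "((\<lambda>x. (\<lambda>(x,y). f (Complex x y)) (g x)) has_integral (1 / 1) *\<^sub>R integral (cbox (Re p, Im p) (Re q, Im q)) (\<lambda>(x,y). f (Complex x y)))
     (h ` cbox (Re p, Im p) (Re q, Im q))"
    by (rule has_integral_twiddle[rotated -1])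
      (use gi hi hg content in \<open>auto simp: g_def intro!: continuous_intros\<close>)
  moreover have "h ` cbox (Re p, Im p) (Re q, Im q) = vec_of_complex ` cbox p q"
  proof -
    have "cbox p q = (\<lambda>(x,y). Complex x y) ` cbox (Re p, Im p) (Re q, Im q)"
      by (auto simp: in_cbox_complex_iff image_iff cbox_Pair_eq complex_eq_iff intro!: bexI[of _ "(Re _, Im _)"])
    then show ?thesis by (simp add: h_def image_image split_beta)
  qed
  moreover have "integral (cbox (Re p, Im p) (Re q, Im q)) (\<lambda>(x,y). f (Complex x y)) =
     integral {Re p..Re q} (\<lambda>x. integral {Im p..Im q} (\<lambda>y. f (Complex x y)))"
    using integral_prod_continuous[OF c] by simp
  ultimately show ?thesis by (simp add: g_def complex_of_vec_def)
qed

lemma has_derivative_vec_of_complex: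
  assumes "(h has_derivative h') (at (complex_of_vec x))"
  shows "((\<lambda>x. vec_of_complex (h (complex_of_vec x))) has_derivative (\<lambda>v. vec_of_complex (h' (complex_of_vec v)))) (at x within S)"
proof -
  note toc = bounded_linear_imp_has_derivative[OF bounded_linear_complex_of_vec]
  note oc = bounded_linear_imp_has_derivative[OF bounded_linear_vec_of_complex]
  have "((\<lambda>x. h (complex_of_vec x)) has_derivative (\<lambda>v. h' (complex_of_vec v))) (at x)"
    by (rule has_derivative_compose[OF toc assms])
  from has_derivative_compose[OF this oc]
  show ?thesis by (rule has_derivative_at_withinI)
qed

lemma vec_of_complex_image_eq: "vec_of_complex ` A = complex_of_vec -` A"
  by (auto simp: image_iff) (metis vec_of_complex_complex_of_vec)

lemma open_vec_of_complex_image: "open A \<Longrightarrow> open (vec_of_complex ` A)"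
  unfolding vec_of_complex_image_eq
  by (intro open_vimage linear_continuous_on bounded_linear_complex_of_vec)

lemma vec_of_complex_image_ball: "vec_of_complex ` ball 0 r = ball 0 r"
  by (auto simp: vec_of_complex_image_eq)

lemma inj_vec_of_complex: "inj vec_of_complex"
  by (metis injI complex_of_vec_vec_of_complex)

lemma negligible_vec_of_complex_boundary: "negligible (vec_of_complex ` cbox p q - vec_of_complex ` box p q)"
proof -
  have eq: "cbox p q = {z. Re z \<in> {Re p..Re q} \<and> Im z \<in> {Im p..Im q}}"
    "box p q = {z. Re z \<in> {Re p<..<Re q} \<and> Im z \<in> {Im p<..<Im q}}"
    by (auto simp: in_cbox_complex_iff in_box_complex_iff)
  have "vec_of_complex ` cbox p q = cbox (vec_of_complex p) (vec_of_complex q)"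
      "vec_of_complex ` box p q = box (vec_of_complex p) (vec_of_complex q)"
    unfolding vec_of_complex_image_eq
    by (auto simp: complex_of_vec_def vec_of_complex_def mem_box_cart forall_2 in_cbox_complex_iff in_box_complex_iff)
  then show ?thesis by (simp add: negligible_frontier_interval)
qed

section \<open>Areas of images\<close>

text \<open>Change of variables with Jacobian |h'|^2. Injectivity concerns the open box only, since
  the \<open>h\<close> of the annulus has period 2 pi i and glues two opposite edges; the boundary
  is negligible for the integral.\<close>

lemma area_injective_image:
  assumes hol: "h holomorphic_on U" "open U" "cbox p q \<subseteq> U" and inj: "inj_on h (box p q)"
  shows "vec_of_complex ` h ` box p q \<in> lmeasurable"
    and "measure lebesgue (vec_of_complex ` h ` box p q) =
      integral {Re p..Re q} (\<lambda>x. integral {Im p..Im q} (\<lambda>y. (cmod (deriv h (Complex x y)))\<^sup>2))"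
proof -
  let ?S = "vec_of_complex ` box p q"
  let ?h = "\<lambda>x. vec_of_complex (h (complex_of_vec x))"
  let ?I = "integral {Re p..Re q} (\<lambda>x. integral {Im p..Im q} (\<lambda>y. (cmod (deriv h (Complex x y)))\<^sup>2))"
  have S: "?S \<in> sets lebesgue"
    by (intro sets_completionI_sets) (simp add: open_vec_of_complex_image borel_open open_box)
  have sub: "box p q \<subseteq> U" using hol(3) box_subset_cbox by blast
  have der: "(?h has_derivative (\<lambda>v. vec_of_complex (deriv h (complex_of_vec x) * complex_of_vec v + 0 * cnj (complex_of_vec v))))
      (at x within ?S)" if "x \<in> ?S" for x
  proof (rule has_derivative_vec_of_complex)
    have "(h has_field_derivative deriv h (complex_of_vec x)) (at (complex_of_vec x))"
      using that sub by (intro holomorphic_derivI[OF hol(1,2)]) auto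
    then show "(h has_derivative (\<lambda>v. deriv h (complex_of_vec x) * v + 0 * cnj v)) (at (complex_of_vec x))"
      by (simp add: has_field_derivative_def)
  qed
  have inj: "inj_on ?h ?S"
    using inj inj_vec_of_complex by (auto simp: inj_on_def)
  have "continuous_on (cbox p q) (\<lambda>z. (cmod (deriv h z))\<^sup>2)"
    by (intro continuous_intros holomorphic_on_imp_continuous_on holomorphic_on_subset[OF holomorphic_deriv hol(3)] hol)
  from has_integral_complex_of_vec[OF this]
  have "((\<lambda>x. (cmod (deriv h (complex_of_vec x)))\<^sup>2) has_integral ?I) ?S"
    by (rule has_integral_spike_set_eq[THEN iffD1, rotated -1])
      (auto intro!: negligible_subset[OF negligible_vec_of_complex_boundary[of p q]]
         simp: box_subset_cbox[THEN subsetD])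
  then have "((\<lambda>x. \<bar>det (matrix (\<lambda>v. vec_of_complex (deriv h (complex_of_vec x) * complex_of_vec v + 0 * cnj (complex_of_vec v))))\<bar>)
      has_integral ?I) ?S"
    unfolding det_real_linear_complex by simp
  then have "?h ` ?S \<in> lmeasurable \<and> measure lebesgue (?h ` ?S) = ?I"
    using has_measure_differentiable_image[OF S der inj] by blast
  moreover have "?h ` ?S = vec_of_complex ` h ` box p q" by (simp add: image_image)
  ultimately show "vec_of_complex ` h ` box p q \<in> lmeasurable" "measure lebesgue (vec_of_complex ` h ` box p q) = ?I"
    by simp_all
qed

text \<open>The Jacobian 1 - |\<phi>'|^2 lies between 0 and 1, and a differentiable image, even
  where it overlaps itself, has area at most the Jacobian bound times the area of the
  source.\<close>

lemma area_antiholomorphic_perturbation: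
  fixes \<phi> :: "complex \<Rightarrow> complex"
  assumes R: "0 \<le> R" and hol: "\<phi> holomorphic_on ball 0 R"
    and bd: "\<And>z. cmod z < R \<Longrightarrow> cmod (deriv \<phi> z) \<le> 1"
  shows "vec_of_complex ` (\<lambda>w. w + \<phi> (cnj w)) ` ball 0 R \<in> lmeasurable"
    and "measure lebesgue (vec_of_complex ` (\<lambda>w. w + \<phi> (cnj w)) ` ball 0 R) \<le> pi * R\<^sup>2"
proof -
  let ?f = "\<lambda>x. vec_of_complex (complex_of_vec x + \<phi> (cnj (complex_of_vec x)))"
  let ?f' = "\<lambda>x v. vec_of_complex (1 * complex_of_vec v + deriv \<phi> (cnj (complex_of_vec x)) * cnj (complex_of_vec v))"
  have der: "(?f has_derivative ?f' x) (at x within ball 0 R)" if "x \<in> ball 0 R" for x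
  proof (rule has_derivative_vec_of_complex[where h = "\<lambda>w. w + \<phi> (cnj w)"])
    have "((\<lambda>w. \<phi> (cnj w)) has_derivative (\<lambda>v. deriv \<phi> (cnj (complex_of_vec x)) * cnj v)) (at (complex_of_vec x))"
      using that
      by (intro has_derivative_compose[OF bounded_linear_imp_has_derivative[OF bounded_linear_cnj]])
         (auto intro!: holomorphic_derivI[OF hol, unfolded has_field_derivative_def])
    then show "((\<lambda>w. w + \<phi> (cnj w)) has_derivative (\<lambda>v. 1 * v + deriv \<phi> (cnj (complex_of_vec x)) * cnj v)) (at (complex_of_vec x))"
      by (auto intro!: derivative_eq_intros)
  qed
  have det: "\<bar>det (matrix (?f' x))\<bar> \<le> 1" if "x \<in> ball 0 R" for x
  proof -
    have "cmod (deriv \<phi> (cnj (complex_of_vec x))) \<le> 1" using that by (intro bd) auto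
    then have "(cmod (deriv \<phi> (cnj (complex_of_vec x))))\<^sup>2 \<le> 1" by (simp add: power_le_one)
    then show ?thesis unfolding det_real_linear_complex by simp
  qed
  have *: "ball 0 R \<in> lmeasurable" by simp
  have "continuous_on (ball 0 R) (\<lambda>z. cmod (deriv \<phi> z))"
    by (intro continuous_intros holomorphic_on_imp_continuous_on holomorphic_deriv hol) simp
  then have "continuous_on (ball 0 R) (\<lambda>x. cmod (deriv \<phi> (cnj (complex_of_vec x))))"
    by (rule continuous_on_compose2)
      (auto intro!: linear_continuous_on bounded_linear_compose[OF bounded_linear_cnj] bounded_linear_complex_of_vec)
  then have "continuous_on (ball 0 R) (\<lambda>x. \<bar>det (matrix (?f' x))\<bar>)"
    unfolding det_real_linear_complex norm_one by (intro continuous_on_rabs continuous_on_diff continuous_on_power continuous_on_const)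
  then have "(\<lambda>x. \<bar>det (matrix (?f' x))\<bar>) \<in> borel_measurable (lebesgue_on (ball 0 R))"
    by (intro continuous_imp_measurable_on_sets_lebesgue) auto
  then have int: "(\<lambda>x. \<bar>det (matrix (?f' x))\<bar>) integrable_on ball 0 R"
    by (rule measurable_bounded_by_integrable_imp_integrable[where g = "\<lambda>_. 1"])
      (use det in \<open>auto simp: integrable_on_const\<close>)
  have "measure lebesgue (ball (0::real^2) R) = pi * R\<^sup>2"
    using R by (simp add: content_ball unit_ball_vol_numeral unit_ball_vol_2)
  moreover have "?f ` ball 0 R = vec_of_complex ` (\<lambda>w. w + \<phi> (cnj w)) ` ball 0 R"
    unfolding vec_of_complex_image_ball[of R, symmetric] image_image by simp
  ultimately
  show "vec_of_complex ` (\<lambda>w. w + \<phi> (cnj w)) ` ball 0 R \<in> lmeasurable"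
    "measure lebesgue (vec_of_complex ` (\<lambda>w. w + \<phi> (cnj w)) ` ball 0 R) \<le> pi * R\<^sup>2"
    using measurable_bounded_differentiable_image[OF * der int det]
      measure_bounded_differentiable_image[OF * der int det] by auto
qed

section \<open>Bessel's inequality on circles\<close>

lemma has_integral_circle_taylor_coeff:
  fixes G :: "complex \<Rightarrow> complex"
  assumes "G holomorphic_on ball 0 1" "0 < r" "r < 1"
  shows "((\<lambda>y. G (of_real r * cis y) * cis (- (real m * y))) has_integral
    2 * pi * ((deriv ^^ m) G 0 / fact m) * of_real r ^ m) {0..2*pi}"
proof -
  have "((\<lambda>u. G u / (u - 0) ^ Suc m) has_contour_integral (2 * pi * \<i>) / fact m * (deriv ^^ m) G 0) (circlepath 0 r)"
    using assms by (intro Cauchy_has_contour_integral_higher_derivative_circlepath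
       holomorphic_on_imp_continuous_on holomorphic_on_subset[OF assms(1)]) auto
  then have "((\<lambda>t. G (of_real r * cis t) / (of_real r * cis t) ^ Suc m * r * \<i> * cis t) has_integral
      (2 * pi * \<i>) / fact m * (deriv ^^ m) G 0) {0..2*pi}"
    unfolding circlepath_def by (subst (asm) has_contour_integral_part_circlepath_iff) auto
  \<comment> \<open>In Cauchy's formula the kernel times the velocity of the circle is
    \<open>\<i> * cis (- m t) / r ^ m\<close>; this factor removes all but the
    \<open>cis\<close>.\<close>
  then have "((\<lambda>t. (of_real r ^ m / \<i>) * (G (of_real r * cis t) / (of_real r * cis t) ^ Suc m * r * \<i> * cis t)) has_integral
      (of_real r ^ m / \<i>) * ((2 * pi * \<i>) / fact m * (deriv ^^ m) G 0)) {0..2*pi}"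
    by (rule has_integral_mult_right)
  moreover have "(of_real r ^ m / \<i>) * (G (of_real r * cis t) / (of_real r * cis t) ^ Suc m * r * \<i> * cis t)
     = G (of_real r * cis t) * cis (- (real m * t))" for t
    using assms by (simp add: power_mult_distrib field_simps Complex.DeMoivre cis_mult flip: cis_inverse cis_cnj)
  moreover have "(of_real r ^ m / \<i>) * ((2 * pi * \<i>) / fact m * (deriv ^^ m) G 0) =
      2 * pi * ((deriv ^^ m) G 0 / fact m) * of_real r ^ m"
    by (simp add: field_simps)
  ultimately show ?thesis by (simp only:)
qed

text \<open>With \<open>P\<close> the Taylor polynomial of degree \<open>N\<close>, integrating |G -
  P|^2 over the circle gives a nonnegative number. Both <G,P> and <P,P> equal
  \<open>2 * pi * S\<close>, so the integral of |G|^2 is at least \<open>2 * pi * S\<close>.\<close>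

lemma circle_bessel_inequality:
  fixes G :: "complex \<Rightarrow> complex"
  assumes hol: "G holomorphic_on ball 0 1" and F: "G has_fps_expansion F" and r: "0 < r" "r < 1"
  shows "2 * pi * (\<Sum>m\<le>N. (cmod (fps_nth F m))\<^sup>2 * r ^ (2 * m)) \<le>
    integral {0..2*pi} (\<lambda>y. (cmod (G (of_real r * cis y)))\<^sup>2)"
proof -
  define c where "c = fps_nth F"
  define P where "P = (\<lambda>z. \<Sum>m\<le>N. c m * z ^ m)"
  define S where "S = (\<Sum>m\<le>N. (cmod (c m))\<^sup>2 * r ^ (2 * m))"
  have cnjP: "cnj (P (of_real r * cis y)) = (\<Sum>m\<le>N. cnj (c m) * of_real r ^ m * cis (- (real m * y)))" for y
    by (simp add: P_def power_mult_distrib Complex.DeMoivre cis_cnj mult.assoc)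
  \<comment> \<open>Pairing with \<open>P\<close> sees only the coefficients up to \<open>N\<close>,
    so one computation serves both \<open>G\<close> and \<open>P\<close>.\<close>
  have inner: "((\<lambda>y. H (of_real r * cis y) * cnj (P (of_real r * cis y))) has_integral of_real (2 * pi * S)) {0..2*pi}"
    if H: "H holomorphic_on ball 0 1" "H has_fps_expansion K" "\<And>m. m \<le> N \<Longrightarrow> fps_nth K m = c m" for H K
  proof -
    have "((\<lambda>y. \<Sum>m\<le>N. cnj (c m) * of_real r ^ m * (H (of_real r * cis y) * cis (- (real m * y))))
        has_integral (\<Sum>m\<le>N. cnj (c m) * of_real r ^ m *
          (2 * pi * ((deriv ^^ m) H 0 / fact m) * of_real r ^ m))) {0..2*pi}"
      by (intro has_integral_sum has_integral_mult_right has_integral_circle_taylor_coeff H(1) r) auto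
    moreover have "(\<Sum>m\<le>N. cnj (c m) * of_real r ^ m * (2 * pi * ((deriv ^^ m) H 0 / fact m) * of_real r ^ m)) =
        of_real (2 * pi * S)"
      unfolding S_def of_real_mult of_real_sum sum_distrib_left
    proof (intro sum.cong refl)
      fix m assume "m \<in> {..N}"
      then have "(deriv ^^ m) H 0 / fact m = c m"
        using fps_nth_fps_expansion[OF H(2), of m] H(3)[of m] by simp
      moreover have "cnj (c m) * c m = of_real (cmod (c m)) * of_real (cmod (c m))"
        by (metis complex_norm_square mult.commute of_real_mult power2_eq_square)
      ultimately show "cnj (c m) * of_real r ^ m * (complex_of_real 2 * complex_of_real pi * ((deriv ^^ m) H 0 / fact m) * of_real r ^ m) =
          complex_of_real 2 * complex_of_real pi * (complex_of_real ((cmod (c m))\<^sup>2) * complex_of_real (r ^ (2 * m)))"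
        by (simp add: power_mult power2_eq_square power_mult_distrib)
    qed
    moreover have "(\<lambda>y. \<Sum>m\<le>N. cnj (c m) * of_real r ^ m * (H (of_real r * cis y) * cis (- (real m * y)))) =
        (\<lambda>y. H (of_real r * cis y) * cnj (P (of_real r * cis y)))"
      unfolding cnjP sum_distrib_left by (simp add: mult_ac)
    ultimately show ?thesis by (simp only:)
  qed
  have Pexp: "P has_fps_expansion (\<Sum>m\<le>N. fps_const (c m) * fps_X ^ m)"
    unfolding P_def by (intro fps_expansion_intros)
  have "fps_nth (\<Sum>m\<le>N. fps_const (c m) * fps_X ^ m) n = c n" if "n \<le> N" for n
    using that by (simp add: fps_sum_nth fps_X_power_nth if_distrib cong: if_cong)
  with Pexp have PP: "((\<lambda>y. P (of_real r * cis y) * cnj (P (of_real r * cis y))) has_integral of_real (2 * pi * S)) {0..2*pi}"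
    by (intro inner) (auto simp: P_def intro!: holomorphic_intros)
  have GP: "((\<lambda>y. G (of_real r * cis y) * cnj (P (of_real r * cis y))) has_integral of_real (2 * pi * S)) {0..2*pi}"
    by (rule inner[OF hol F]) (simp add: c_def)
  have "continuous_on {0..2*pi} (\<lambda>y. (cmod (G (of_real r * cis y)))\<^sup>2)"
    by (intro continuous_intros continuous_on_compose2[OF holomorphic_on_imp_continuous_on[OF hol]])
      (use r in \<open>auto simp: norm_mult\<close>)
  then have GG: "((\<lambda>y. (cmod (G (of_real r * cis y)))\<^sup>2) has_integral
      integral {0..2*pi} (\<lambda>y. (cmod (G (of_real r * cis y)))\<^sup>2)) {0..2*pi}"
    by (intro integrable_integral integrable_continuous_real)
  note Re = has_integral_linear[OF _ bounded_linear_Re, unfolded o_def]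
  have "((\<lambda>y. (cmod (G (of_real r * cis y)))\<^sup>2 - 2 * Re (G (of_real r * cis y) * cnj (P (of_real r * cis y)))
        + Re (P (of_real r * cis y) * cnj (P (of_real r * cis y)))) has_integral
      integral {0..2*pi} (\<lambda>y. (cmod (G (of_real r * cis y)))\<^sup>2) - 2 * Re (of_real (2 * pi * S)) + Re (of_real (2 * pi * S)))
      {0..2*pi}"
    by (intro has_integral_add has_integral_diff has_integral_mult_right GG Re[OF GP] Re[OF PP])
  moreover have "0 \<le> (cmod a)\<^sup>2 - 2 * Re (a * cnj b) + Re (b * cnj b)" for a b :: complex
  proof -
    have "(cmod a)\<^sup>2 - 2 * Re (a * cnj b) + Re (b * cnj b) = (cmod (a - b))\<^sup>2"
      unfolding cmod_power2 by (simp add: power2_eq_square algebra_simps)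
    then show ?thesis by simp
  qed
  ultimately have "0 \<le> integral {0..2*pi} (\<lambda>y. (cmod (G (of_real r * cis y)))\<^sup>2)
      - 2 * Re (of_real (2 * pi * S)) + Re (of_real (2 * pi * S))"
    by (rule has_integral_nonneg)
  then show ?thesis by (simp add: S_def c_def)
qed

section \<open>Lower bound for the area of the image of an annulus\<close>

text \<open>In the coordinate u = log z the annulus, slit along a radius, is a rectangle. There the
  area is an integral over x = Re u of circle integrals; Bessel bounds each of them from below, and
  the bound is integrated explicitly. \<open>A\<close> is the image of the open rectangle.\<close>

lemma area_annulus_image:
  fixes \<beta> :: "complex \<Rightarrow> complex"
  defines "k \<equiv> (\<lambda>z. 1 / z + \<beta> z)"
  assumes hol: "\<beta> holomorphic_on ball 0 1" and B: "\<beta> has_fps_expansion B"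
    and inj: "inj_on k (ball 0 1 - {0})" and s: "0 < s" "s < \<rho>" "\<rho> < 1"
  obtains A where "A \<subseteq> k ` {z. s < cmod z \<and> cmod z < 1}" "vec_of_complex ` A \<in> lmeasurable"
    "pi * (1 / s\<^sup>2 - 1 / \<rho>\<^sup>2 + (\<Sum>n\<le>N. real n * (cmod (fps_nth B n))\<^sup>2 * (\<rho> ^ (2 * n) - s ^ (2 * n))))
      \<le> measure lebesgue (vec_of_complex ` A)"
proof -
  define p q where "p = Complex (ln s) 0" and "q = Complex (ln \<rho>) (2 * pi)"
  define U where "U = {z. Re z < 0}"
  define h where "h = (\<lambda>u. k (exp u))"
  \<comment> \<open>This is \<open>z^2 * k'(z)\<close>, which extends holomorphically over the pole
    of \<open>k\<close> at 0; the chain rule gives \<open>h' = G (exp u) / exp u\<close>.\<close>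
  define G where "G = (\<lambda>z. - 1 + z ^ 2 * deriv \<beta> z)"
  have "open U" unfolding U_def by (rule open_halfspace_Re_lt)
  have sub: "cbox p q \<subseteq> U"
    using s by (auto simp: in_cbox_complex_iff p_def q_def U_def intro: le_less_trans[of _ "ln \<rho>"])
  have expU: "exp u \<in> ball 0 1 - {0}" if "u \<in> U" for u
    using that by (simp add: U_def)
  have "k holomorphic_on ball 0 1 - {0}"
    unfolding k_def using hol by (auto intro!: holomorphic_intros intro: holomorphic_on_subset)
  then have holh: "h holomorphic_on U"
    unfolding h_def using expU
    by (intro holomorphic_on_compose_gen[of exp U k "ball 0 1 - {0}", unfolded o_def]) (auto intro!: holomorphic_intros)
  have dh: "deriv h u = G (exp u) / exp u" if "u \<in> U" for u
  proof (rule DERIV_imp_deriv)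
    have "(\<beta> has_field_derivative deriv \<beta> (exp u)) (at (exp u))"
      using expU[OF that] by (intro holomorphic_derivI[OF hol]) auto
    then have "((\<lambda>u. \<beta> (exp u)) has_field_derivative deriv \<beta> (exp u) * exp u) (at u)"
      by (rule DERIV_chain2) (rule DERIV_exp)
    then show "(h has_field_derivative G (exp u) / exp u) (at u)"
      unfolding h_def k_def G_def
      by (auto intro!: derivative_eq_intros simp: field_simps power2_eq_square)
  qed
  have injh: "inj_on h (box p q)"
  proof (rule inj_onI)
    fix u v assume uv: "u \<in> box p q" "v \<in> box p q" "h u = h v"
    then have "u \<in> U" "v \<in> U" using sub box_subset_cbox by blast+
    then have "exp u = exp v" using uv(3) inj_onD[OF inj, of "exp u" "exp v"] expU by (simp add: h_def)
    moreover have "\<bar>Im u - Im v\<bar> < 2 * pi" using uv(1,2) by (auto simp: in_box_complex_iff p_def q_def)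
    ultimately show "u = v" using exp_complex_eqI by blast
  qed
  have holG: "G holomorphic_on ball 0 1"
    unfolding G_def by (intro holomorphic_intros hol) auto
  have Gexp: "G has_fps_expansion (- 1 + fps_X ^ 2 * fps_deriv B)"
    unfolding G_def by (intro fps_expansion_intros B)
  have G0: "fps_nth (- 1 + fps_X ^ 2 * fps_deriv B) 0 = -1"
    by (simp add: fps_X_power_mult_nth)
  \<comment> \<open>The factor \<open>z^2\<close> moves n B_n from index n - 1 to n + 1. Hence
    \<open>Suc N\<close> and the exponents \<open>2 * Suc n\<close> below, which the factor
    \<open>exp (-2 * x)\<close> lowers to \<open>2 * n\<close>.\<close>
  have GSuc: "fps_nth (- 1 + fps_X ^ 2 * fps_deriv B) (Suc n) = of_nat n * fps_nth B n" for n
    by (cases n) (auto simp: fps_X_power_mult_nth)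
  define b where "b = (\<lambda>n. (cmod (fps_nth B n))\<^sup>2)"
  let ?J = "\<lambda>x. integral {0..2*pi} (\<lambda>y. (cmod (deriv h (Complex x y)))\<^sup>2)"
  have inner: "2 * pi * (exp (-2 * x) + (\<Sum>n\<le>N. (real n)\<^sup>2 * b n * exp (2 * real n * x))) \<le> ?J x"
    if x: "x \<in> {ln s..ln \<rho>}" for x
  proof -
    have "x < 0" using x s by (auto intro: le_less_trans[of _ "ln \<rho>"])
    then have r: "0 < exp x" "exp x < 1" by auto
    have "Complex x y \<in> U" for y using \<open>x < 0\<close> by (simp add: U_def)
    moreover have "exp (Complex x y) = of_real (exp x) * cis y" for y
      by (subst exp_eq_polar) simp
    ultimately have "(cmod (deriv h (Complex x y)))\<^sup>2 = exp (- 2 * x) * (cmod (G (of_real (exp x) * cis y)))\<^sup>2" for y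
      by (simp add: dh norm_divide norm_mult power_divide exp_minus field_simps flip: exp_double)
    then have "?J x = exp (- 2 * x) * integral {0..2*pi} (\<lambda>y. (cmod (G (of_real (exp x) * cis y)))\<^sup>2)"
      by simp
    also have "\<dots> \<ge> exp (- 2 * x) * (2 * pi * (\<Sum>m\<le>Suc N. (cmod (fps_nth (- 1 + fps_X ^ 2 * fps_deriv B) m))\<^sup>2 * exp x ^ (2 * m)))"
      by (intro mult_left_mono circle_bessel_inequality holG Gexp r) auto
    also have "(\<Sum>m\<le>Suc N. (cmod (fps_nth (- 1 + fps_X ^ 2 * fps_deriv B) m))\<^sup>2 * exp x ^ (2 * m)) =
        1 + (\<Sum>n\<le>N. (real n)\<^sup>2 * b n * exp x ^ (2 * Suc n))"
      unfolding sum.atMost_Suc_shift G0 GSuc by (simp add: b_def norm_mult power_mult_distrib)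
    also have "exp (- 2 * x) * (2 * pi * (1 + (\<Sum>n\<le>N. (real n)\<^sup>2 * b n * exp x ^ (2 * Suc n)))) =
        2 * pi * (exp (-2 * x) + (\<Sum>n\<le>N. (real n)\<^sup>2 * b n * (exp (-2 * x) * exp x ^ (2 * Suc n))))"
      by (simp add: algebra_simps sum_distrib_left)
    also have "(\<lambda>n. exp (-2 * x) * exp x ^ (2 * Suc n)) = (\<lambda>n. exp (2 * real n * x))"
      by (simp add: algebra_simps flip: exp_of_nat_mult exp_add)
    finally show ?thesis .
  qed
  \<comment> \<open>The weight \<open>real n * b n / 2\<close>, in place of a division of
    \<open>(real n)^2 * b n\<close> by \<open>2 * real n\<close>, makes the case
    \<open>n = 0\<close> uniform.\<close>
  have deriv_primitive: "((\<lambda>x. 2 * pi * (- exp (-2 * x) / 2 + (\<Sum>n\<le>N. real n * b n * exp (2 * real n * x) / 2)))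
      has_vector_derivative 2 * pi * (exp (-2 * x) + (\<Sum>n\<le>N. (real n)\<^sup>2 * b n * exp (2 * real n * x)))) (at x within X)" for x X
    unfolding has_real_derivative_iff_has_vector_derivative[symmetric]
    by (auto intro!: derivative_eq_intros sum.cong simp: power2_eq_square)
  have "((\<lambda>x. 2 * pi * (exp (-2 * x) + (\<Sum>n\<le>N. (real n)\<^sup>2 * b n * exp (2 * real n * x)))) has_integral
     2 * pi * (- exp (-2 * ln \<rho>) / 2 + (\<Sum>n\<le>N. real n * b n * exp (2 * real n * ln \<rho>) / 2)) -
     2 * pi * (- exp (-2 * ln s) / 2 + (\<Sum>n\<le>N. real n * b n * exp (2 * real n * ln s) / 2))) {ln s..ln \<rho>}"
    using s by (intro fundamental_theorem_of_calculus deriv_primitive) auto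
  moreover have "2 * pi * (- exp (-2 * ln \<rho>) / 2 + (\<Sum>n\<le>N. real n * b n * exp (2 * real n * ln \<rho>) / 2)) -
     2 * pi * (- exp (-2 * ln s) / 2 + (\<Sum>n\<le>N. real n * b n * exp (2 * real n * ln s) / 2)) =
     pi * (1 / s\<^sup>2 - 1 / \<rho>\<^sup>2 + (\<Sum>n\<le>N. real n * b n * (\<rho> ^ (2 * n) - s ^ (2 * n))))"
  proof -
    have "exp (-2 * ln r) = 1 / r\<^sup>2" "exp (2 * real n * ln r) = r ^ (2 * n)" if "0 < r" for r :: real and n
    proof -
      have e: "exp (real m * ln r) = r ^ m" for m using that by (simp add: exp_of_nat_mult)
      show "exp (-2 * ln r) = 1 / r\<^sup>2" using e[of 2] by (simp add: exp_minus field_simps)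
      show "exp (2 * real n * ln r) = r ^ (2 * n)" using e[of "2 * n"] by simp
    qed
    with s show ?thesis
      by (simp add: sum_subtractf right_diff_distrib sum_divide_distrib[symmetric] algebra_simps)
  qed
  ultimately have low: "((\<lambda>x. 2 * pi * (exp (-2 * x) + (\<Sum>n\<le>N. (real n)\<^sup>2 * b n * exp (2 * real n * x)))) has_integral
     pi * (1 / s\<^sup>2 - 1 / \<rho>\<^sup>2 + (\<Sum>n\<le>N. real n * b n * (\<rho> ^ (2 * n) - s ^ (2 * n))))) {ln s..ln \<rho>}"
    by simp
  have "continuous_on (cbox (ln s, 0) (ln \<rho>, 2*pi)) (\<lambda>(x,y). (cmod (deriv h (Complex x y)))\<^sup>2)"
    unfolding split_beta
    by (intro continuous_intros continuous_on_compose2[OF holomorphic_on_imp_continuous_on[OF holomorphic_deriv[OF holh \<open>open U\<close>]]])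
      (use sub in \<open>auto simp: Complex_eq in_cbox_complex_iff p_def q_def cbox_Pair_eq intro!: continuous_intros\<close>)
  from integral_integrable_2dim[OF this]
  have "?J integrable_on {ln s..ln \<rho>}" by simp
  then have "(?J has_integral integral {ln s..ln \<rho>} ?J) {ln s..ln \<rho>}"
    by (rule integrable_integral)
  from has_integral_le[OF low this] inner
  have "pi * (1 / s\<^sup>2 - 1 / \<rho>\<^sup>2 + (\<Sum>n\<le>N. real n * b n * (\<rho> ^ (2 * n) - s ^ (2 * n)))) \<le>
      integral {ln s..ln \<rho>} ?J" by blast
  also have "\<dots> = measure lebesgue (vec_of_complex ` h ` box p q)"
    using area_injective_image(2)[OF holh \<open>open U\<close> sub injh] by (simp add: p_def q_def)
  finally have "pi * (1 / s\<^sup>2 - 1 / \<rho>\<^sup>2 + (\<Sum>n\<le>N. real n * (cmod (fps_nth B n))\<^sup>2 * (\<rho> ^ (2 * n) - s ^ (2 * n))))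
      \<le> measure lebesgue (vec_of_complex ` h ` box p q)" by (simp add: b_def)
  moreover have "h ` box p q \<subseteq> k ` {z. s < cmod z \<and> cmod z < 1}"
  proof
    fix w assume "w \<in> h ` box p q"
    then obtain u where u: "u \<in> box p q" "w = k (exp u)" by (auto simp: h_def)
    then have "ln s < Re u" "u \<in> U" using sub box_subset_cbox[of p q] by (force simp: in_box_complex_iff p_def)+
    moreover from this have "exp (ln s) < exp (Re u)" by simp
    ultimately have "s < cmod (exp u)" "cmod (exp u) < 1"
      using s by (auto simp: U_def)
    with u show "w \<in> k ` {z. s < cmod z \<and> cmod z < 1}" by blast
  qed
  ultimately show ?thesis
    using that area_injective_image(1)[OF holh \<open>open U\<close> sub injh] by blast
qed

section \<open>Reflection in the unit circle and the enclosing set\<close>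

text \<open>On the unit circle \<open>1 / z = cnj z\<close>, so the branches match: inversion
  outside is continued inside by conjugation, avoiding the pole.\<close>

definition disc_reflection :: "complex \<Rightarrow> complex" where
  "disc_reflection z = (if cmod z < 1 then cnj z else 1 / z)"

lemma cmod_disc_reflection_le: "cmod (disc_reflection z) \<le> 1"
  by (simp add: disc_reflection_def norm_divide divide_le_eq)

text \<open>Conjugation is an isometry, and inversion divides distances by |z||w|, at least 1
  outside. In the mixed case, after multiplication by |w|, the difference of squares factors as
  (|w|^2 - 1)(|w|^2 + 1 - 2 Re (cnj z w)), with both factors nonnegative.\<close>

lemma disc_reflection_lipschitz: "cmod (disc_reflection z - disc_reflection w) \<le> cmod (z - w)"
proof -
  have outer: "cmod (1 / z - 1 / w) \<le> cmod (z - w)" if "1 \<le> cmod z" "1 \<le> cmod w" for z w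
  proof -
    have "z \<noteq> 0" "w \<noteq> 0" using that by auto
    then have "cmod (1 / z - 1 / w) * (cmod z * cmod w) = cmod (z - w)"
      by (simp add: norm_minus_commute diff_frac_eq norm_divide norm_mult)
    moreover have "1 * 1 \<le> cmod z * cmod w" using that by (intro mult_mono) auto
    ultimately show ?thesis using mult_left_mono[of 1 "cmod z * cmod w" "cmod (1 / z - 1 / w)"] by (metis mult_1 mult.right_neutral norm_ge_zero)
  qed
  have mixed: "cmod (cnj z - 1 / w) \<le> cmod (z - w)" if zw: "cmod z < 1" "1 \<le> cmod w" for z w
  proof -
    have "w \<noteq> 0" using zw by auto
    have "Re (cnj z * w) \<le> cmod z * cmod w" using complex_Re_le_cmod[of "cnj z * w"] by (simp add: norm_mult)
    also have "\<dots> \<le> cmod w" using zw mult_right_mono[of "cmod z" 1 "cmod w"] by simp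
    also have "\<dots> \<le> ((cmod w)\<^sup>2 + 1) / 2" using zero_le_power2[of "cmod w - 1"] by (simp add: power2_diff)
    finally have "0 \<le> ((cmod w)\<^sup>2 - 1) * ((cmod w)\<^sup>2 + 1 - 2 * Re (cnj z * w))"
      using zw by (intro mult_nonneg_nonneg) (auto simp: one_le_power)
    also have "\<dots> = (cmod w * cmod (z - w))\<^sup>2 - (cmod (cnj z * w - 1))\<^sup>2"
      unfolding power_mult_distrib cmod_power2 by (simp add: power2_eq_square algebra_simps)
    finally have "(cmod (cnj z * w - 1))\<^sup>2 \<le> (cmod w * cmod (z - w))\<^sup>2"
      by (simp only: diff_ge_0_iff_ge)
    then have "cmod (cnj z * w - 1) \<le> cmod w * cmod (z - w)"
      by (rule power2_le_imp_le) simp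
    moreover have "cmod (cnj z * w - 1) = cmod w * cmod (cnj z - 1 / w)"
    proof -
      have "cnj z * w - 1 = w * (cnj z - 1 / w)" using \<open>w \<noteq> 0\<close> by (simp add: field_simps)
      then show ?thesis by (simp only: norm_mult)
    qed
    ultimately show ?thesis using \<open>w \<noteq> 0\<close> by simp
  qed
  have inner: "cmod (cnj z - cnj w) = cmod (z - w)" for z w
    by (metis complex_cnj_diff complex_mod_cnj)
  show ?thesis
    using outer[of z w] mixed[of z w] mixed[of w z] inner[of z w]
    unfolding disc_reflection_def by (auto simp: norm_minus_commute not_less)
qed

text \<open>The map \<open>w \<mapsto> w + \<beta> (of_real s * disc_reflection (of_real s * w))\<close> is a contractive perturbation of the
  identity, hence surjective; outside \<open>ball 0 (1 / s)\<close> it is the given univalent function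
  in the coordinate \<open>w = 1 / z\<close>.\<close>

lemma univalent_image_enclosed:
  fixes \<beta> :: "complex \<Rightarrow> complex" and s :: real
  defines "k \<equiv> (\<lambda>z. 1 / z + \<beta> z)"
  assumes hol: "\<beta> holomorphic_on ball 0 1" and inj: "inj_on k (ball 0 1 - {0})"
    and s: "0 < s" "s < 1" and L: "\<And>z. cmod z \<le> s \<Longrightarrow> cmod (deriv \<beta> z) \<le> L" "s\<^sup>2 * L < 1"
  shows "k ` {z. s < cmod z \<and> cmod z < 1} \<subseteq> (\<lambda>w. w + \<beta> (of_real s ^ 2 * cnj w)) ` ball 0 (1 / s)"
proof (rule image_subsetI)
  fix z assume z: "z \<in> {z. s < cmod z \<and> cmod z < 1}"
  \<comment> \<open>A fixed point of \<open>T\<close> is a preimage of \<open>k z\<close> under the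
    perturbed identity. The two scalings by \<open>s\<close> and the bound \<open>L\<close> make
    \<open>T\<close> a contraction with factor \<open>s^2 * L\<close>.\<close>
  define T where "T = (\<lambda>w. k z - \<beta> (of_real s * disc_reflection (of_real s * w)))"
  have L0: "0 \<le> L" using order_trans[OF norm_ge_zero L(1)[of 0]] s by simp
  have lip: "cmod (\<beta> u - \<beta> v) \<le> L * cmod (u - v)" if "cmod u \<le> s" "cmod v \<le> s" for u v
  proof (rule field_differentiable_bound[of "cball 0 s" \<beta> "deriv \<beta>"])
    fix z :: complex assume "z \<in> cball 0 s"
    then show "(\<beta> has_field_derivative deriv \<beta> z) (at z within cball 0 s)"
      using s by (intro holomorphic_derivI[OF hol, THEN has_field_derivative_at_within]) auto
    show "cmod (deriv \<beta> z) \<le> L" using \<open>z \<in> cball 0 s\<close> L(1) by simp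
  qed (use that in auto)
  have refl: "cmod (of_real s * disc_reflection w) \<le> s" for w
    using s cmod_disc_reflection_le[of w] by (simp add: norm_mult mult_left_le)
  have "dist (T u) (T v) \<le> s\<^sup>2 * L * dist u v" for u v
  proof -
    have "dist (T u) (T v) \<le> L * cmod (of_real s * disc_reflection (of_real s * u) - of_real s * disc_reflection (of_real s * v))"
      using lip[OF refl refl, of "of_real s * u" "of_real s * v"] by (simp add: T_def dist_norm norm_minus_commute)
    also have "\<dots> = L * (s * cmod (disc_reflection (of_real s * u) - disc_reflection (of_real s * v)))"
      using s by (simp add: norm_mult flip: right_diff_distrib)
    also have "\<dots> \<le> L * (s * cmod (of_real s * u - of_real s * v))"
      using s L0 by (intro mult_left_mono disc_reflection_lipschitz) auto
    also have "\<dots> = s\<^sup>2 * L * dist u v"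
      using s by (simp add: norm_mult dist_norm power2_eq_square flip: right_diff_distrib)
    finally show ?thesis .
  qed
  then obtain w where "T w = w"
    using banach_fix_type[of "s\<^sup>2 * L" T] L0 L(2) by auto
  then have w: "k z = w + \<beta> (of_real s * disc_reflection (of_real s * w))" by (auto simp: T_def algebra_simps)
  show "k z \<in> (\<lambda>w. w + \<beta> (of_real s ^ 2 * cnj w)) ` ball 0 (1 / s)"
  proof (cases "cmod (of_real s * w) < 1")
    case True
    then have "w \<in> ball 0 (1 / s)" using s by (simp add: norm_mult field_simps)
    with True w show ?thesis
      by (intro image_eqI[of _ _ w]) (auto simp: disc_reflection_def power2_eq_square mult.assoc)
  next
    \<comment> \<open>Here the reflection is an inversion, so \<open>k z = k (1 / w)\<close>;
      injectivity forces \<open>z = 1 / w\<close> with modulus at most \<open>s\<close>,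
      contradicting the choice of \<open>z\<close>.\<close>
    case False
    then have "1 \<le> s * cmod w" using s by (simp add: norm_mult)
    moreover from this have "w \<noteq> 0" by auto
    ultimately have ws: "1 / cmod w \<le> s" by (simp add: divide_le_eq)
    have "k z = k (1 / w)" using False s \<open>w \<noteq> 0\<close> w by (simp add: disc_reflection_def k_def)
    moreover have "z \<in> ball 0 1 - {0}" using z s by auto
    moreover have "1 / w \<in> ball 0 1 - {0}" using le_less_trans[OF ws s(2)] \<open>w \<noteq> 0\<close> by (simp add: norm_divide)
    ultimately have "z = 1 / w" using inj_onD[OF inj] by blast
    with ws z show ?thesis by (simp add: norm_divide)
  qed
qed

section \<open>Gronwall's area theorem\<close>

theorem area_theorem:
  fixes \<beta> :: "complex \<Rightarrow> complex"
  assumes hol: "\<beta> holomorphic_on ball 0 1" and B: "\<beta> has_fps_expansion B"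
    and inj: "inj_on (\<lambda>z. 1 / z + \<beta> z) (ball 0 1 - {0})"
  shows "(\<Sum>n\<le>N. real n * (cmod (fps_nth B n))\<^sup>2) \<le> 1"
proof -
  have "continuous_on (cball 0 (1 / 2)) (deriv \<beta>)"
    by (intro holomorphic_on_imp_continuous_on holomorphic_on_subset[OF holomorphic_deriv[OF hol]]) auto
  then have "bounded (deriv \<beta> ` cball 0 (1 / 2))"
    by (intro compact_imp_bounded compact_continuous_image) auto
  then obtain L where L: "0 < L" "\<And>z. cmod z \<le> 1 / 2 \<Longrightarrow> cmod (deriv \<beta> z) \<le> L"
    unfolding bounded_pos by auto
  define b where "b = (\<lambda>n. (cmod (fps_nth B n))\<^sup>2)"
  \<comment> \<open>The lower and the upper area bound share the divergent term
    \<open>1 / s^2\<close>, which cancels. The restrictions on \<open>s\<close> give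
    \<open>s^2 * L < 1\<close>, used both for the contraction and for |\<phi>'| \<le> 1.\<close>
  have main: "(\<Sum>n\<le>N. real n * b n * ((1 - s) ^ (2 * n) - s ^ (2 * n))) \<le> 1 / (1 - s)\<^sup>2"
    if s: "0 < s" "s < 1 / 2" "s < 1 / L" for s
  proof -
    have "s\<^sup>2 * L = s * (s * L)" by (simp add: power2_eq_square)
    also have "\<dots> < 1 * 1" using s L(1) by (intro mult_strict_mono) (auto simp: field_simps)
    finally have sL: "s\<^sup>2 * L < 1" by simp
    obtain A where A: "A \<subseteq> (\<lambda>z. 1 / z + \<beta> z) ` {z. s < cmod z \<and> cmod z < 1}" "vec_of_complex ` A \<in> lmeasurable"
      "pi * (1 / s\<^sup>2 - 1 / (1 - s)\<^sup>2 + (\<Sum>n\<le>N. real n * b n * ((1 - s) ^ (2 * n) - s ^ (2 * n))))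
        \<le> measure lebesgue (vec_of_complex ` A)"
      unfolding b_def by (rule area_annulus_image[OF hol B inj, of s "1 - s" N]) (use s in auto)
    define \<phi> where "\<phi> = (\<lambda>z. \<beta> (of_real s ^ 2 * z))"
    have sR: "cmod (of_real s ^ 2 * z) < s" if "cmod z < 1 / s" for z
      using that s by (simp add: norm_mult norm_power power2_eq_square field_simps)
    have d\<phi>: "(\<phi> has_field_derivative of_real s ^ 2 * deriv \<beta> (of_real s ^ 2 * z)) (at z)" if "cmod z < 1 / s" for z
    proof -
      have "(\<beta> has_field_derivative deriv \<beta> (of_real s ^ 2 * z)) (at (of_real s ^ 2 * z))"
        using sR[OF that] s by (intro holomorphic_derivI[OF hol]) auto
      moreover have "((\<lambda>z. of_real s ^ 2 * z) has_field_derivative of_real s ^ 2) (at z)"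
        by (auto intro!: derivative_eq_intros)
      ultimately show ?thesis unfolding \<phi>_def by (metis DERIV_chain2 mult.commute)
    qed
    have "\<phi> holomorphic_on ball 0 (1 / s)"
      using d\<phi> by (intro holomorphic_onI) (auto simp: field_differentiable_def dest: has_field_derivative_at_within)
    moreover have "cmod (deriv \<phi> z) \<le> 1" if "cmod z < 1 / s" for z
    proof -
      have "cmod (deriv \<phi> z) = s\<^sup>2 * cmod (deriv \<beta> (of_real s ^ 2 * z))"
        using DERIV_imp_deriv[OF d\<phi>[OF that]] by (simp add: norm_mult norm_power)
      also have "\<dots> \<le> s\<^sup>2 * L" using sR[OF that] s by (intro mult_left_mono L(2)) auto
      finally show ?thesis using sL by simp
    qed
    ultimately have E: "vec_of_complex ` (\<lambda>w. w + \<phi> (cnj w)) ` ball 0 (1 / s) \<in> lmeasurable"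
      "measure lebesgue (vec_of_complex ` (\<lambda>w. w + \<phi> (cnj w)) ` ball 0 (1 / s)) \<le> pi * (1 / s)\<^sup>2"
      using area_antiholomorphic_perturbation[of "1 / s" \<phi>] s by auto
    have "A \<subseteq> (\<lambda>w. w + \<phi> (cnj w)) ` ball 0 (1 / s)"
      using univalent_image_enclosed[OF hol inj, of s L] A(1) s L sL unfolding \<phi>_def by force
    then have "measure lebesgue (vec_of_complex ` A) \<le> measure lebesgue (vec_of_complex ` (\<lambda>w. w + \<phi> (cnj w)) ` ball 0 (1 / s))"
      using A(2) E(1) by (intro measure_mono_fmeasurable) auto
    with A(3) E(2) have "pi * (1 / s\<^sup>2 - 1 / (1 - s)\<^sup>2 + (\<Sum>n\<le>N. real n * b n * ((1 - s) ^ (2 * n) - s ^ (2 * n))))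
        \<le> pi * (1 / s\<^sup>2)" by (simp add: power_divide)
    then have "1 / s\<^sup>2 - 1 / (1 - s)\<^sup>2 + (\<Sum>n\<le>N. real n * b n * ((1 - s) ^ (2 * n) - s ^ (2 * n))) \<le> 1 / s\<^sup>2"
      by (simp only: mult_le_cancel_left_pos[OF pi_gt_zero])
    then show ?thesis by simp
  qed
  have "((\<lambda>s::real. \<Sum>n\<le>N. real n * b n * ((1 - s) ^ (2 * n) - s ^ (2 * n))) \<longlongrightarrow>
      (\<Sum>n\<le>N. real n * b n * ((1 - 0) ^ (2 * n) - 0 ^ (2 * n)))) (at_right 0)"
    by (intro tendsto_intros)
  \<comment> \<open>At \<open>n = 0\<close>, where \<open>0 ^ 0 = 1\<close>, the weight
    \<open>real n\<close> vanishes.\<close>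
  moreover have "(\<Sum>n\<le>N. real n * b n * ((1 - 0) ^ (2 * n) - 0 ^ (2 * n))) = (\<Sum>n\<le>N. real n * b n)"
    by (intro sum.cong) (auto simp: power_0_left)
  moreover have "((\<lambda>s::real. 1 / (1 - s)\<^sup>2) \<longlongrightarrow> 1 / (1 - 0)\<^sup>2) (at_right 0)"
    by (intro tendsto_intros) auto
  moreover have "eventually (\<lambda>s. s \<in> {0<..<min (1 / 2) (1 / L)}) (at_right 0)"
    using L(1) by (intro eventually_at_right_real) auto
  then have "eventually (\<lambda>s. (\<Sum>n\<le>N. real n * b n * ((1 - s) ^ (2 * n) - s ^ (2 * n))) \<le> 1 / (1 - s)\<^sup>2) (at_right 0)"
    by eventually_elim (rule main, auto)
  ultimately have "(\<Sum>n\<le>N. real n * b n) \<le> 1 / (1 - 0)\<^sup>2"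
    by (intro tendsto_le[OF trivial_limit_at_right_real]) (simp_all only:)
  then show ?thesis by (simp add: b_def)
qed

section \<open>The extremal problem for the quartic\<close>

text \<open>Weighted AM-GM absorbs the terms in \<open>b\<close>, \<open>e\<close>, \<open>w\<close>
  into the area constraint divided by \<open>2 * m\<close>, with \<open>m\<close> as inverse
  multiplier. What remains is a rational inequality in \<open>A\<close> alone;
  \<open>0.510599\<close> exceeds the true maximum enough to permit an affine
  \<open>m\<close>.\<close>

lemma quartic_bound:
  fixes a b e w :: real
  assumes a: "0 \<le> a" and area: "a\<^sup>2 + 3 * b\<^sup>2 + 5 * e\<^sup>2 + 7 * w\<^sup>2 \<le> 1"
  shows "w + a * e + b\<^sup>2 / 2 + a\<^sup>2 * b + a ^ 4 / 4 \<le> 0.510599"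
proof -
  define A where "A = a\<^sup>2"
  \<comment> \<open>Near the maximum, at \<open>A = 0.67088\<dots>\<close>, the optimal weight \<open>1 / m\<close> in the following weighted
    AM-GM inequalities has \<open>m\<close> nearly affine in \<open>A\<close>; a constant weight would lose the bound.\<close>
  define m where "m = 1.847 - 1.6 * A"
  have A: "0 \<le> A" "A \<le> 1"
    using area by (auto simp: A_def) (smt (verit) zero_le_power2)
  \<comment> \<open>\<open>m < 3\<close> makes \<open>3 / (2 * m) - 1 / 2\<close> positive, so that
    the square in \<open>b\<close> can be completed.\<close>
  then have m: "0 < m" "m < 3" by (auto simp: m_def)
  have e: "a * e \<le> 5 * e\<^sup>2 / (2 * m) + A * m / 10"
  proof -
    have "0 \<le> (5 * e - a * m)\<^sup>2 / (10 * m)" using m by simp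
    then show ?thesis using m by (simp add: A_def field_simps power2_eq_square)
  qed
  have w: "w \<le> 7 * w\<^sup>2 / (2 * m) + m / 14"
  proof -
    have "0 \<le> (7 * w - m)\<^sup>2 / (14 * m)" using m by simp
    then show ?thesis using m by (simp add: field_simps power2_eq_square)
  qed
  have b: "b\<^sup>2 / 2 + A * b \<le> 3 * b\<^sup>2 / (2 * m) + A\<^sup>2 * m / (2 * (3 - m))"
  proof -
    have "0 \<le> ((3 - m) * b - A * m)\<^sup>2 / (2 * m * (3 - m))" using m by simp
    also have "\<dots> = 3 * b\<^sup>2 / (2 * m) + A\<^sup>2 * m / (2 * (3 - m)) - (b\<^sup>2 / 2 + A * b)"
      using m by (simp add: divide_simps) (simp add: algebra_simps power2_eq_square)
    finally show ?thesis by simp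
  qed
  have R: "3 * b\<^sup>2 / (2 * m) + 5 * e\<^sup>2 / (2 * m) + 7 * w\<^sup>2 / (2 * m) \<le> (1 - A) / (2 * m)"
    using area m by (simp add: A_def divide_simps)
  have key: "0 \<le> 0.510599 * m * (3 - m) - (1 - A) * (3 - m) / 2 - (A / 10 + 1 / 14) * m\<^sup>2 * (3 - m)
      - A\<^sup>2 * m * (3 - m) / 4 - A\<^sup>2 * m\<^sup>2 / 2" (is "0 \<le> ?q")
  proof -
    \<comment> \<open>\<open>?q\<close> is \<open>m * (3 - m)\<close> times the slack. Around 0.67,
      close to the maximizer, \<open>14 * ?q\<close> is a quadratic times t^2 plus a small affine
      part; the quadratic is at least 7 on the range, and 7 (t - 0.002)^2 \<ge> 0 then controls the
      affine part.\<close>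
    define t where "t = A - 0.67"
    have t: "-0.67 \<le> t" "t \<le> 0.33" and At: "A = t + 0.67" using A by (auto simp: t_def)
    have "0 \<le> (t + 0.67) * (0.33 - t)" using t by (intro mult_nonneg_nonneg) auto
    \<comment> \<open>The quadratic is concave, so its minimum is at an endpoint; the preceding
      product encodes the interval.\<close>
    then have "7 \<le> 790621817 / 50000000 + 48693 / 15625 * t - 9184 / 625 * t\<^sup>2"
      using t by (simp add: algebra_simps power2_eq_square)
    then have "7 * t\<^sup>2 \<le> (790621817 / 50000000 + 48693 / 15625 * t - 9184 / 625 * t\<^sup>2) * t\<^sup>2"
      by (intro mult_right_mono) auto
    moreover have "0 \<le> 7 * t\<^sup>2 - 0.028 * t + 0.000028"
      using zero_le_power2[of "t - 0.002"] by (simp add: power2_eq_square algebra_simps)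
    moreover have "0 \<le> X - 5589129 / 200000000 * t + 181887 / 800000000"
      if "7 * t\<^sup>2 \<le> X" "0 \<le> 7 * t\<^sup>2 - 0.028 * t + 0.000028" for X
      using that t by simp
    ultimately have "0 \<le> (790621817 / 50000000 + 48693 / 15625 * t - 9184 / 625 * t\<^sup>2) * t\<^sup>2 - 5589129 / 200000000 * t + 181887 / 800000000"
      by blast
    also have "\<dots> = 14 * ?q"
      unfolding m_def At by (simp add: field_simps power2_eq_square)
    finally show ?thesis by simp
  qed
  have "(1 - A) / (2 * m) + A * m / 10 + m / 14 + A\<^sup>2 / 4 + A\<^sup>2 * m / (2 * (3 - m)) =
     0.510599 - ?q / (m * (3 - m))"
    using m by (simp add: divide_simps) (simp add: algebra_simps power2_eq_square)
  also have "\<dots> \<le> 0.510599" using key m by simp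
  finally have "w + a * e + (b\<^sup>2 / 2 + A * b) + A\<^sup>2 / 4 \<le> 0.510599" using e w b R by linarith
  then show ?thesis by (simp add: A_def algebra_simps flip: power_mult)
qed

section \<open>From the area theorem to the fourth logarithmic coefficient\<close>

text \<open>The recursion is the coefficient form of E' = - (g / 2)' E for E = exp (- g / 2);
  solving it for \<open>\<gamma> 4\<close> gives the fourth coefficient of - log E.\<close>

lemma fourth_log_coeff_formula:
  fixes E \<gamma> :: "nat \<Rightarrow> complex"
  assumes "E 0 = 1"
    and rec: "\<And>n. of_nat (Suc n) * E (Suc n) = - (\<Sum>i\<le>n. of_nat (Suc i) * \<gamma> (Suc i) * E (n - i))"
  shows "\<gamma> 4 = - E 4 + E 1 * E 3 + (E 2)\<^sup>2 / 2 - (E 1)\<^sup>2 * E 2 + (E 1) ^ 4 / 4"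
proof -
  have g1: "\<gamma> 1 = - E 1" using rec[of 0] assms(1) by simp
  have "2 * E 2 = - (\<gamma> 1 * E 1 + 2 * \<gamma> 2)"
    using rec[of 1] assms(1) by (simp add: eval_nat_numeral)
  then have g2: "\<gamma> 2 = - E 2 + (E 1)\<^sup>2 / 2" unfolding g1 by (simp add: power2_eq_square field_simps)
  have "3 * E 3 = - (\<gamma> 1 * E 2 + 2 * \<gamma> 2 * E 1 + 3 * \<gamma> 3)"
    using rec[of 2] assms(1) by (simp add: eval_nat_numeral)
  then have g3: "3 * \<gamma> 3 = - 3 * E 3 + E 1 * E 2 - 2 * \<gamma> 2 * E 1" unfolding g1 by algebra
  have "4 * E 4 = - (\<gamma> 1 * E 3 + 2 * \<gamma> 2 * E 2 + 3 * \<gamma> 3 * E 1 + 4 * \<gamma> 4)"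
    using rec[of 3] assms(1) by (simp add: eval_nat_numeral)
  moreover have "2 * \<gamma> 2 = - 2 * E 2 + (E 1)\<^sup>2" unfolding g2 by simp
  ultimately have "4 * \<gamma> 4 = - 4 * E 4 + 4 * E 1 * E 3 + 2 * (E 2)\<^sup>2 - 4 * (E 1)\<^sup>2 * E 2 + (E 1) ^ 4"
    using g3 unfolding g1 by algebra
  then have "\<gamma> 4 = (- 4 * E 4 + 4 * E 1 * E 3 + 2 * (E 2)\<^sup>2 - 4 * (E 1)\<^sup>2 * E 2 + (E 1) ^ 4) / 4"
    by (metis nonzero_mult_div_cancel_left zero_neq_numeral)
  then show ?thesis by (simp add: add_divide_distrib diff_divide_distrib)
qed

text \<open>The area theorem applied to the reciprocal of the odd square root transform
  \<open>z \<mapsto> sqrt (f (z\<^sup>2))\<close>.\<close>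

lemma class_S_area_inequality:
  assumes f: "f \<in> class_S" and g: "is_log_ratio f g" and E: "(\<lambda>u. exp (- g u / 2)) has_fps_expansion F"
  shows "(\<Sum>n\<le>N. real (2 * n + 1) * (cmod (fps_nth F (Suc n)))\<^sup>2) \<le> 1"
proof -
  have holg: "g holomorphic_on ball 0 1" and g0: "g 0 = 0"
    and eg: "\<And>z. z \<in> ball 0 1 - {0} \<Longrightarrow> exp (g z) = f z / z"
    using g by (auto simp: is_log_ratio_def)
  define e where "e = (\<lambda>u. exp (- g u / 2))"
  have hole: "e holomorphic_on ball 0 1" unfolding e_def by (intro holomorphic_intros holg) auto
  have e0: "e 0 = 1" by (simp add: e_def g0)
  define d where "d = (\<lambda>u. if u = 0 then deriv e 0 else (e u - 1) / u)"
  have hold: "d holomorphic_on ball 0 1"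
    using pole_lemma_open[OF hole open_ball, of 0] by (simp add: d_def[abs_def] e0 cong: if_cong)
  have du: "u * d u = e u - 1" for u by (simp add: d_def e0)
  define D where "D = fps_expansion d 0"
  have Dexp: "d has_fps_expansion D"
    unfolding D_def by (rule has_fps_expansion_fps_expansion[OF open_ball _ hold]) simp
  have "(\<lambda>u. u * d u) has_fps_expansion fps_X * D" by (intro fps_expansion_intros Dexp)
  moreover have "(\<lambda>u. e u - 1) has_fps_expansion F - 1"
    using E unfolding e_def by (intro fps_expansion_intros)
  ultimately have "fps_X * D = F - 1" unfolding du by (rule fps_expansion_unique_complex)
  then have Dn: "fps_nth D n = fps_nth F (Suc n)" for n
    by (drule_tac arg_cong[where f = "\<lambda>H. fps_nth H (Suc n)"]) simp
  \<comment> \<open>Chosen so that \<open>1 / z + \<beta> z = e (z^2) / z\<close>, whose square is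
    \<open>1 / f (z^2)\<close>.\<close>
  define \<beta> where "\<beta> = (\<lambda>z. z * d (z\<^sup>2))"
  have sq: "z\<^sup>2 \<in> ball 0 1" if "z \<in> ball 0 1" for z :: complex
    using that by (simp add: norm_power power_less_one_iff)
  have hol\<beta>: "\<beta> holomorphic_on ball 0 1"
    unfolding \<beta>_def using sq
    by (intro holomorphic_intros holomorphic_on_compose_gen[OF _ hold, unfolded o_def]) auto
  have "(d \<circ> (\<lambda>z. z\<^sup>2)) has_fps_expansion fps_compose (D) (fps_X ^ 2)"
    by (intro has_fps_expansion_compose Dexp fps_expansion_intros) simp
  then have \<beta>exp: "\<beta> has_fps_expansion fps_X * fps_compose (D) (fps_X ^ 2)"
    unfolding \<beta>_def o_def by (intro fps_expansion_intros)
  have k: "1 / z + \<beta> z = e (z\<^sup>2) / z" if "z \<noteq> 0" for z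
    using that du[of "z\<^sup>2"] by (simp add: \<beta>_def field_simps power2_eq_square)
  have ksq: "(1 / z + \<beta> z)\<^sup>2 = 1 / f (z\<^sup>2)" if z: "z \<in> ball 0 1 - {0}" for z
  proof -
    have "(e (z\<^sup>2))\<^sup>2 = 1 / exp (g (z\<^sup>2))"
      by (simp add: e_def exp_minus field_simps flip: exp_double)
    moreover have "exp (g (z\<^sup>2)) = f (z\<^sup>2) / z\<^sup>2"
      using z sq[of z] by (intro eg) auto
    ultimately show ?thesis using z by (simp add: k power_divide)
  qed
  have "inj_on (\<lambda>z. 1 / z + \<beta> z) (ball 0 1 - {0})"
  proof (rule inj_onI)
    fix z w assume zw: "z \<in> ball 0 1 - {0}" "w \<in> ball 0 1 - {0}" "1 / z + \<beta> z = 1 / w + \<beta> w"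
    then have "1 / f (z\<^sup>2) = 1 / f (w\<^sup>2)" using ksq[of z] ksq[of w] by metis
    then have "f (z\<^sup>2) = f (w\<^sup>2)" by simp
    then have "z\<^sup>2 = w\<^sup>2" using f zw sq unfolding class_S_def inj_on_def by blast
    then consider "z = w" | "z = - w" using power2_eq_iff by blast
    then show "z = w"
    proof cases
      \<comment> \<open>The function \<open>e (z^2) / z\<close> is odd, so equal values at
        \<open>w\<close> and \<open>- w\<close> would force the exponential \<open>e (w^2)\<close>
        to vanish.\<close>
      case 2
      have "e (z\<^sup>2) / z = e (w\<^sup>2) / w" using zw k[of z] k[of w] by auto
      with 2 zw(2) have "e (w\<^sup>2) = 0" by (simp add: field_simps)
      then show ?thesis by (simp add: e_def)
    qed
  qed
  from area_theorem[OF hol\<beta> \<beta>exp this, of "2 * N + 1"]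
  have "(\<Sum>n\<le>2 * N + 1. real n * (cmod (fps_nth (fps_X * fps_compose (D) (fps_X ^ 2)) n))\<^sup>2) \<le> 1" .
  \<comment> \<open>The coefficients of \<beta> sit at odd indices; there \<open>2 * n + 1\<close>
    is also the area weight.\<close>
  moreover have "fps_nth (fps_X * fps_compose (D) (fps_X ^ 2)) (2 * n + 1) = fps_nth F (Suc n)" for n
    by (simp add: fps_nth_compose_X_power Dn)
  then have "(\<Sum>n\<le>N. real (2 * n + 1) * (cmod (fps_nth F (Suc n)))\<^sup>2) =
      (\<Sum>n\<in>(\<lambda>n. 2 * n + 1) ` {..N}. real n * (cmod (fps_nth (fps_X * fps_compose (D) (fps_X ^ 2)) n))\<^sup>2)"
    by (subst sum.reindex) (auto simp: inj_on_def)
  moreover have "\<dots> \<le> (\<Sum>n\<le>2 * N + 1. real n * (cmod (fps_nth (fps_X * fps_compose (D) (fps_X ^ 2)) n))\<^sup>2)"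
    by (intro sum_mono2) auto
  ultimately show ?thesis by linarith
qed

text \<open>The triangle inequality reduces the formula to moduli. It loses nothing against the area
  constraint: with \<open>E 1\<close>, \<open>E 3\<close> positive and \<open>E 2\<close>,
  \<open>E 4\<close> negative all terms are positive.\<close>

lemma fourth_log_coeff_bound:
  assumes f: "f \<in> class_S" and \<gamma>: "log_coeffs f \<gamma>"
  shows "cmod (\<gamma> 4) \<le> 0.510599"
proof -
  obtain g where g: "is_log_ratio f g"
    and sums: "\<And>z. z \<in> ball 0 1 \<Longrightarrow> (\<lambda>n. 2 * (\<gamma> (Suc n) * z ^ Suc n)) sums g z"
    using \<gamma> unfolding log_coeffs_def by blast
  \<comment> \<open>Index 0 is set to 0 because \<open>\<gamma> 0\<close> is arbitrary; the
    composition with \<open>exp\<close> needs a zero constant term.\<close>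
  define K where "K = Abs_fps (\<lambda>n. if n = 0 then 0 else 2 * \<gamma> n)"
  have g0: "g 0 = 0" using g by (simp add: is_log_ratio_def)
  have "g has_fps_expansion K"
  proof (rule has_fps_expansionI)
    have "eventually (\<lambda>z. z \<in> ball 0 1) (nhds (0::complex))"
      by (intro eventually_nhds_in_open) auto
    then show "\<forall>\<^sub>F z in nhds 0. (\<lambda>n. fps_nth K n * z ^ n) sums g z"
    proof eventually_elim
      case (elim z)
      from sums[OF this] show ?case
        using sums_Suc_iff[of "\<lambda>n. fps_nth K n * z ^ n" "g z"] by (simp add: K_def mult.assoc)
    qed
  qed
  moreover define F where "F = fps_compose (fps_exp 1) (fps_const (- 1 / 2) * K)"
  ultimately have "(exp \<circ> (\<lambda>u. - 1 / 2 * g u)) has_fps_expansion F"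
    unfolding F_def using has_fps_expansion_exp[of 1]
    by (intro has_fps_expansion_compose fps_expansion_intros) (auto simp: K_def)
  then have Fexp: "(\<lambda>u. exp (- g u / 2)) has_fps_expansion F" by (simp add: o_def)
  have F0: "fps_nth F 0 = 1" by (simp add: F_def)
  have "fps_deriv F = F * (fps_const (- 1 / 2) * fps_deriv K)"
    unfolding F_def by (subst fps_compose_deriv) (auto simp: K_def)
  then have "fps_deriv F = fps_const (- 1 / 2) * (fps_deriv K * F)"
    by (simp only: mult_ac)
  then have "fps_nth (fps_deriv F) n = - 1 / 2 * (\<Sum>i=0..n. fps_nth (fps_deriv K) i * fps_nth F (n - i))" for n
    by (simp only: fps_mult_left_const_nth fps_mult_nth[of "fps_deriv K"])
  then have rec: "of_nat (Suc n) * fps_nth F (Suc n) =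
      - (\<Sum>i\<le>n. of_nat (Suc i) * \<gamma> (Suc i) * fps_nth F (n - i))" for n
    by (simp add: K_def sum_distrib_left atMost_atLeast0 mult_ac flip: sum_negf)
  define E where "E = fps_nth F"
  have area: "(cmod (E 1))\<^sup>2 + 3 * (cmod (E 2))\<^sup>2 + 5 * (cmod (E 3))\<^sup>2 + 7 * (cmod (E 4))\<^sup>2 \<le> 1"
    using class_S_area_inequality[OF f g Fexp, of 3] by (simp add: E_def eval_nat_numeral)
  have "\<gamma> 4 = - E 4 + E 1 * E 3 + (E 2)\<^sup>2 / 2 - (E 1)\<^sup>2 * E 2 + (E 1) ^ 4 / 4"
    using F0 rec by (intro fourth_log_coeff_formula) (simp_all add: E_def)
  also have "cmod \<dots> \<le> cmod (E 4) + cmod (E 1 * E 3) + cmod ((E 2)\<^sup>2 / 2) + cmod ((E 1)\<^sup>2 * E 2) + cmod ((E 1) ^ 4 / 4)"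
    by (intro norm_triangle_le norm_triangle_le_diff add_mono order_refl) simp
  also have "\<dots> = cmod (E 4) + cmod (E 1) * cmod (E 3) + (cmod (E 2))\<^sup>2 / 2 + (cmod (E 1))\<^sup>2 * cmod (E 2) + cmod (E 1) ^ 4 / 4"
    by (simp add: norm_mult norm_power norm_divide)
  also have "\<dots> \<le> 0.510599" by (rule quartic_bound[OF _ area]) simp
  finally show ?thesis .
qed

theorem theorem1:
  shows "\<exists>c::real. 0.51059 \<le> c \<and> c < 0.51060 \<and>
    (\<forall>f \<gamma>. f \<in> class_S \<longrightarrow> log_coeffs f \<gamma> \<longrightarrow> cmod (\<gamma> 4) \<le> c)"
  using fourth_log_coeff_bound by (intro exI[of _ "0.510599"]) auto

end
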